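(* Suppose $\{f_n\}_{n=1}^\infty$ is a sequence of bounded Lebesgue measurable functions $f_n:[0,1]\to\mathbb{R}$ and $f:[0,1]\to\mathbb{R}$ is a bounded function such that $\lim_{n\to\infty}f_n(x)=f(x)$ for almost all $x$. Suppose also there is a constant $M>0$ such that for each $n>0$, $|f_n(x)|\le M$ for almost all $x\in[0,1]$. Then $f$ is a measurable function, satisfying $|f(x)|\le M$ for almost all $x\in[0,1]$, and $$\lim_{n\to\infty}\int f_n\,d\mu=\int f\,d\mu .$$
   Context: $\mu$ is Lebesgue measure on $[0,1]$; "for almost all $x$" means for all $x$ outside a set of Lebesgue measure zero. A function is (Lebesgue) measurable if $f^{-1}([-\infty,a])$ is Lebesgue measurable for every $a$. A simple function is $\sum_{i=1}^n r_i\chi_{A_i}$ with $r_i\in\mathbb{R}$ and $\{A_i\}$ a finite partition of $[0,1]$ into Lebesgue measurable sets ($\chi_A$ is the characteristic function of $A$); its integral is $\sum_{i=1}^n r_i\mu(A_i)$. For a bounded measurable $f$, $\int f\,d\mu$ is the infimum of the integrals of simple functions $u\ge f$ (equivalently the supremum of integrals of simple functions $v\le f$). *)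

theory Defs
  imports "HOL-Analysis.Analysis"
begin

text \<open>
  A function \<open>[0,1] \<rightarrow> \<real>\<close> is represented by a total function \<open>real \<Rightarrow> real\<close> whose values outside
  \<open>{0..1}\<close> are irrelevant; the measure is \<open>lebesgue_on {0..1}\<close>, whose sigma-algebra consists of
  the Lebesgue measurable subsets of \<open>{0..1}\<close>. Bounded measurable functions
  are integrable, so the library's Lebesgue integral is never its default value \<open>0\<close> on them. On simple
  functions it is the finite sum \<open>\<Sum>i. r\<^sub>i * \<mu>(A\<^sub>i)\<close>, and on bounded measurable functions it is the
  infimum of the integrals of the simple functions above:
\<close>

lemma bounded_measurable_integrable_unit:
  fixes f :: "real \<Rightarrow> real"
  assumes "f \<in> borel_measurable (lebesgue_on {0..1})" and "bounded (f ` {0..1})"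
  shows "integrable (lebesgue_on {0..1}) f"
proof -
  interpret finite_measure "lebesgue_on {0..1::real}"
    by (rule finite_measure_lebesgue_on) simp
  obtain B where "\<And>x. x \<in> {0..1} \<Longrightarrow> norm (f x) \<le> B"
    using assms(2) unfolding bounded_iff by (metis image_eqI real_norm_def)
  then have "AE x in lebesgue_on {0..1}. norm (f x) \<le> B"
    by (intro AE_I2) (auto simp: space_restrict_space)
  then show ?thesis
    using assms(1) integrable_const_bound by blast
qed

lemma simple_function_integral_unit:
  fixes u :: "real \<Rightarrow> real"
  assumes "simple_function (lebesgue_on {0..1}) u"
  shows "integral\<^sup>L (lebesgue_on {0..1}) u =
    (\<Sum>r\<in>u ` {0..1}. r * measure lebesgue {x\<in>{0..1}. u x = r})"
proof -
  let ?M = "lebesgue_on {0..1::real}"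
  interpret finite_measure ?M
    by (rule finite_measure_lebesgue_on) simp
  have sp: "space ?M = {0..1}" by (simp add: space_restrict_space)
  have "Bochner_Integration.simple_bochner_integrable ?M u"
    using assms by (auto simp: Bochner_Integration.simple_bochner_integrable.simps)
  then have "integral\<^sup>L ?M u = Bochner_Integration.simple_bochner_integral ?M u"
    by (rule simple_bochner_integrable_eq_integral[symmetric])
  also have "\<dots> = (\<Sum>r\<in>u ` {0..1}. r * measure ?M {x\<in>{0..1}. u x = r})"
    by (simp add: simple_bochner_integral_def sp mult.commute)
  also have "\<dots> = (\<Sum>r\<in>u ` {0..1}. r * measure lebesgue {x\<in>{0..1}. u x = r})"
    by (intro sum.cong refl arg_cong2[where f="(*)"] measure_restrict_space) auto
  finally show ?thesis .
qed

lemma integral_unit_eq_Inf_simple: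
  fixes f :: "real \<Rightarrow> real"
  assumes f: "f \<in> borel_measurable (lebesgue_on {0..1})" and bd: "bounded (f ` {0..1})"
  shows "integral\<^sup>L (lebesgue_on {0..1}) f =
    Inf {integral\<^sup>L (lebesgue_on {0..1}) u | u.
          simple_function (lebesgue_on {0..1}) u \<and> (\<forall>x\<in>{0..1}. f x \<le> u x)}"
    (is "?I = Inf ?S")
proof -
  let ?M = "lebesgue_on {0..1::real}"
  interpret finite_measure ?M
    by (rule finite_measure_lebesgue_on) simp
  have sp: "space ?M = {0..1}" by (simp add: space_restrict_space)
  have m1: "measure ?M (space ?M) = 1"
    by (simp add: sp measure_restrict_space)
  have int_simple: "integrable ?M u" if "simple_function ?M u" for u :: "real \<Rightarrow> real"
  proof (rule bounded_measurable_integrable_unit)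
    show "u \<in> borel_measurable ?M" using that by (rule borel_measurable_simple_function)
    show "bounded (u ` {0..1})"
      using simple_functionD(1)[OF that] by (simp add: sp finite_imp_bounded)
  qed
  have intf: "integrable ?M f" by (rule bounded_measurable_integrable_unit[OF f bd])
  have lower: "?I \<le> y" if "y \<in> ?S" for y
    using that by (auto simp: sp intro!: integral_mono intf int_simple)
  have approx: "\<exists>y\<in>?S. y \<le> ?I + e" if e: "e > 0" for e
  proof -
    define u where "u x = e * of_int \<lceil>f x / e\<rceil>" for x
    obtain B where B: "\<And>x. x \<in> {0..1} \<Longrightarrow> \<bar>f x\<bar> \<le> B"
      using bd unfolding bounded_iff by (metis image_eqI real_norm_def)
    have "(\<lambda>x. \<lceil>f x / e\<rceil>) ` {0..1} \<subseteq> {\<lceil>- B / e\<rceil>..\<lceil>B / e\<rceil>}"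
    proof clarsimp
      fix x :: real assume "0 \<le> x" "x \<le> 1"
      then have "- B \<le> f x" "f x \<le> B" using B[of x] by auto
      then show "\<lceil>- (B / e)\<rceil> \<le> \<lceil>f x / e\<rceil> \<and> \<lceil>f x / e\<rceil> \<le> \<lceil>B / e\<rceil>"
        using e divide_right_mono[of "- B" "f x" e] divide_right_mono[of "f x" B e]
        by (auto intro!: ceiling_mono)
    qed
    then have "finite ((\<lambda>x. \<lceil>f x / e\<rceil>) ` {0..1})"
      by (rule finite_subset) simp
    then have "finite ((\<lambda>k. e * of_int k) ` (\<lambda>x. \<lceil>f x / e\<rceil>) ` {0..1})"
      by (rule finite_imageI)
    then have fin: "finite (u ` space ?M)"
      by (simp add: image_image u_def sp)
    have "u \<in> borel_measurable ?M"
      unfolding u_def using f by measurable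
    then have su: "simple_function ?M u"
      using fin by (rule simple_function_borel_measurable)
    have ge: "f x \<le> u x" for x
      using e by (simp add: u_def field_simps) (metis le_of_int_ceiling mult.commute pos_divide_le_eq)
    have le: "u x \<le> f x + e" for x
    proof -
      have "of_int \<lceil>f x / e\<rceil> \<le> f x / e + 1" by linarith
      then have "e * of_int \<lceil>f x / e\<rceil> \<le> e * (f x / e + 1)" using e by simp
      then show ?thesis using e by (simp add: u_def algebra_simps)
    qed
    have "integral\<^sup>L ?M u \<le> integral\<^sup>L ?M (\<lambda>x. f x + e)"
      using le by (intro integral_mono int_simple su Bochner_Integration.integrable_add intf) auto
    also have "\<dots> = ?I + e"
      using intf m1 by simp
    finally show ?thesis using su ge by blast
  qed
  have "?S \<noteq> {}" using approx[of 1] by auto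
  have "bdd_below ?S" using lower by (rule bdd_belowI)
  have "Inf ?S \<le> ?I + e" if "e > 0" for e
    using approx[OF that] \<open>bdd_below ?S\<close> by (meson cInf_lower order_trans)
  then have "Inf ?S \<le> ?I" by (rule field_le_epsilon)
  moreover have "?I \<le> Inf ?S" using \<open>?S \<noteq> {}\<close> lower by (rule cInf_greatest)
  ultimately show ?thesis by linarith
qed

end

theory Submission
  imports Defs
begin

text \<open>
  The theorem is the bounded case of dominated convergence. The unit interval has finite measure, so
  the constant \<open>M\<close> is an integrable majorant, and the convergence of the integrals follows once the
  limit \<open>g\<close> is known to be measurable. Measurability is where Lebesgue rather than Borel measure
  matters: the convergence may fail on a null set, where \<open>g\<close> is unrelated to the \<open>f n\<close>. The
  function \<open>\<lambda>x. lim (\<lambda>n. f n x)\<close> is measurable and agrees with \<open>g\<close> almost everywhere, and in a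
  complete measure space a change on a null set keeps a function measurable
  (\<open>measurable_AE_eq\<close>); Lebesgue measure on \<open>{0..1}\<close> inherits completeness from Lebesgue measure on
  the line (\<open>complete_measure_restrict_space\<close>). Finally the bound passes to the limit at every
  point where the convergence and all the countably many bounds on the \<open>f n\<close> hold, and almost every
  point is of this kind.
\<close>

lemma complete_measure_restrict_space:
  assumes "complete_measure M" and S: "S \<in> sets M"
  shows "complete_measure (restrict_space M S)"
proof
  fix A B assume "B \<subseteq> A" "A \<in> null_sets (restrict_space M S)"
  then have "A \<subseteq> S" "A \<in> null_sets M"
    by (simp_all add: null_sets_restrict_space[OF S])
  with \<open>B \<subseteq> A\<close> have "B \<subseteq> S" "B \<in> sets M"
    by (blast, metis complete_measure.complete[OF assms(1)])
  then show "B \<in> sets (restrict_space M S)"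
    using S by (auto simp: sets_restrict_space)
qed

text \<open>
  A preimage under \<open>g\<close> differs from the preimage under \<open>f\<close> of the same set only inside a null set,
  and by completeness every subset of a null set is measurable.
\<close>

lemma (in complete_measure) measurable_AE_eq:
  assumes f: "f \<in> M \<rightarrow>\<^sub>M N" and eq: "AE x in M. f x = g x" and g: "g \<in> space M \<rightarrow> space N"
  shows "g \<in> M \<rightarrow>\<^sub>M N"
proof (rule measurableI)
  show "g x \<in> space N" if "x \<in> space M" for x
    using g that by auto
  show "g -` A \<inter> space M \<in> sets M" if "A \<in> sets N" for A
  proof (rule in_sets_AE)
    show "AE x in M. x \<in> f -` A \<inter> space M \<longleftrightarrow> x \<in> g -` A \<inter> space M"
      using eq by eventually_elim auto
    show "f -` A \<inter> space M \<in> sets M"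
      using f that by (rule measurable_sets)
  qed auto
qed

lemma (in complete_measure) borel_measurable_AE_LIMSEQ:
  fixes f :: "nat \<Rightarrow> 'a \<Rightarrow> 'b::{banach, second_countable_topology}"
  assumes f: "\<And>n. f n \<in> borel_measurable M"
    and lim: "AE x in M. (\<lambda>n. f n x) \<longlonglongrightarrow> g x"
  shows "g \<in> borel_measurable M"
proof (rule measurable_AE_eq)
  show "(\<lambda>x. lim (\<lambda>n. f n x)) \<in> borel_measurable M"
    using f by (rule borel_measurable_lim_metric)
  show "AE x in M. lim (\<lambda>n. f n x) = g x"
    using lim by eventually_elim (rule limI)
qed simp

lemma AE_norm_le_LIMSEQ:
  fixes f :: "nat \<Rightarrow> 'a \<Rightarrow> 'b::real_normed_vector"
  assumes lim: "AE x in M. (\<lambda>n. f n x) \<longlonglongrightarrow> g x"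
    and bound: "\<And>n. AE x in M. norm (f n x) \<le> C"
  shows "AE x in M. norm (g x) \<le> C"
proof -
  have "AE x in M. \<forall>n. norm (f n x) \<le> C"
    using bound by (simp add: AE_all_countable)
  with lim show ?thesis
  proof eventually_elim
    case (elim x)
    then show ?case
      by (intro LIMSEQ_le_const2[OF tendsto_norm]) auto
  qed
qed

theorem theorem3p3p4:
  fixes f :: "nat \<Rightarrow> real \<Rightarrow> real" and g :: "real \<Rightarrow> real" and M :: real
  assumes f_meas: "\<And>n. n > 0 \<Longrightarrow> f n \<in> borel_measurable (lebesgue_on {0..1})"
    and f_bdd: "\<And>n. n > 0 \<Longrightarrow> bounded (f n ` {0..1})"
    and g_bdd: "bounded (g ` {0..1})"
    and lim: "AE x in lebesgue_on {0..1}. (\<lambda>n. f n x) \<longlonglongrightarrow> g x"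
    and M_pos: "M > 0"
    and f_le: "\<And>n. n > 0 \<Longrightarrow> AE x in lebesgue_on {0..1}. \<bar>f n x\<bar> \<le> M"
  shows "g \<in> borel_measurable (lebesgue_on {0..1})
    \<and> (AE x in lebesgue_on {0..1}. \<bar>g x\<bar> \<le> M)
    \<and> (\<lambda>n. integral\<^sup>L (lebesgue_on {0..1}) (f n)) \<longlonglongrightarrow> integral\<^sup>L (lebesgue_on {0..1}) g"
proof -
  let ?L = "lebesgue_on {0..1::real}"
  interpret finite_measure ?L
    by (rule finite_measure_lebesgue_on) simp
  interpret complete_measure ?L
    by (rule complete_measure_restrict_space[OF completion.complete_measure_axioms]) simp
  \<comment> \<open>Nothing is assumed about \<open>f 0\<close>, so the argument runs on the shifted sequence.\<close>
  have lim': "AE x in ?L. (\<lambda>n. f (Suc n) x) \<longlonglongrightarrow> g x"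
    using lim by eventually_elim (rule LIMSEQ_Suc)
  have g_meas: "g \<in> borel_measurable ?L"
    by (rule borel_measurable_AE_LIMSEQ[OF f_meas lim']) simp
  have g_le: "AE x in ?L. \<bar>g x\<bar> \<le> M"
    unfolding real_norm_def[symmetric]
    by (rule AE_norm_le_LIMSEQ[OF lim']) (simp add: f_le)
  have "(\<lambda>n. integral\<^sup>L ?L (f (Suc n))) \<longlonglongrightarrow> integral\<^sup>L ?L g"
  proof (rule integral_dominated_convergence[where w = "\<lambda>_. M"])
    show "AE x in ?L. norm (f (Suc n) x) \<le> M" for n
      by (simp add: f_le)
  qed (rule g_meas f_meas lim' integrable_const zero_less_Suc)+
  then have "(\<lambda>n. integral\<^sup>L ?L (f n)) \<longlonglongrightarrow> integral\<^sup>L ?L g"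
    by (rule LIMSEQ_imp_Suc)
  with g_meas g_le show ?thesis by blast
qed

end
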